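(* Let $K=(G,M,I)$ be a finite context, let $z\in G$, let $H=G\setminus\{z\}$, and let $K_H=(H,M,I\cap (H\times M))$ be the corresponding subcontext. Assume that $z^{\square\square}\neq\{z\}$, where $z^{\square\square}$ is the class containing $z$ of the finest extent partition of $(G,M,I)$. For a classification tree $\mathcal{T}$ in $\mathcal{B}(K_H)$ put $$\mathcal{T}^{\ast}=\{E\in\mathcal{T}\mid E\in\mathcal{B}(G,M,I)\}\cup\{E\cup\{z\}\mid E\in\mathcal{T},\ E\cup\{z\}\in\mathcal{B}(G,M,I)\}.$$ Then: (i) For each classification tree $\mathcal{T}_G\subseteq\mathcal{B}(G,M,I)$ there exists a classification tree $\mathcal{T}_H\subseteq\mathcal{B}(K_H)$ such that $\mathcal{T}_G=\mathcal{T}_H^{\ast}$. (ii) If $\mathcal{T}_G\subseteq\mathcal{B}(G,M,I)$ is a maximal classification tree, then there exists a maximal classification tree $\mathcal{M}$ in $\mathcal{B}(K_H)$ such that $\mathcal{T}_G=\mathcal{M}^{\ast}$.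
   Context: A context is a triple $(G,M,I)$ with sets $G$ (objects), $M$ (attributes) and a relation $I\subseteq G\times M$. For $A\subseteq G$, $A'=\{m\in M\mid (g,m)\in I \text{ for all } g\in A\}$; for $B\subseteq M$, $B'=\{g\in G\mid (g,m)\in I\text{ for all } m\in B\}$. A (concept) extent is a set $A\subseteq G$ with $A''=A$. Standing assumptions: $G$ and $M$ are finite and nonempty, every object $g\in G$ has at least one attribute, and every attribute $m\in M$ is held by at least one object of $G$. An extent partition of $(G,M,I)$ is a partition of $G$ all of whose classes are extents. Common refinements of extent partitions are extent partitions, so there is a finest extent partition $\pi_\square$; for $g\in G$, $g^{\square\square}$ denotes the class of $\pi_\square$ containing $g$. A box extent of $(G,M,I)$ is a set $E\subseteq G$ that is a class of some extent partition of $(G,M,I)$ or equals $\emptyset''$. $\mathcal{B}(G,M,I)$ is the set of all box extents ordered by inclusion; it is a complete lattice with greatest element $G$ and least element $\emptyset''$. For the subcontext $K_H$ the derivation operators, extents, extent partitions and box extents are those computed in $K_H$ itself. In a lattice $L$ with least element $0$ and greatest element $1$, a nonempty subset $T\subseteq L\setminus\{0\}$ is a classification tree if for each $x\in L\setminus\{0\}$ the set $[x)\cap T$ is a nonempty chain, where $[x)=\{y\in L\mid y\geq x\}$. A classification tree is maximal if no other classification tree of $L$ contains it as a proper subset.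
   Formalization: Adds the hypothesis ∅'' ≠ G∖{z}; if every object except z has all attributes and z does not, {G} is a maximal classification tree of B(G,M,I) but B(K_H) has one element and no classification tree, so the claim fails. *)

theory Defs
  imports "HOL-Library.Disjoint_Sets"
begin

section \<open>Formal contexts and extents\<close>

definition object_derivation :: "'m set \<Rightarrow> ('g \<times> 'm) set \<Rightarrow> 'g set \<Rightarrow> 'm set" where
  "object_derivation M I A = {m \<in> M. \<forall>g\<in>A. (g, m) \<in> I}"

definition attribute_derivation :: "'g set \<Rightarrow> ('g \<times> 'm) set \<Rightarrow> 'm set \<Rightarrow> 'g set" where
  "attribute_derivation G I B = {g \<in> G. \<forall>m\<in>B. (g, m) \<in> I}"

definition extent_closure :: "'g set \<Rightarrow> 'm set \<Rightarrow> ('g \<times> 'm) set \<Rightarrow> 'g set \<Rightarrow> 'g set" where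
  "extent_closure G M I A = attribute_derivation G I (object_derivation M I A)"

definition extent :: "'g set \<Rightarrow> 'm set \<Rightarrow> ('g \<times> 'm) set \<Rightarrow> 'g set \<Rightarrow> bool" where
  "extent G M I A \<longleftrightarrow> A \<subseteq> G \<and> extent_closure G M I A = A"


section \<open>Extent partitions and box extents\<close>

definition extent_partition :: "'g set \<Rightarrow> 'm set \<Rightarrow> ('g \<times> 'm) set \<Rightarrow> 'g set set \<Rightarrow> bool" where
  "extent_partition G M I P \<longleftrightarrow> partition_on G P \<and> (\<forall>A\<in>P. extent G M I A)"

definition is_finest_extent_partition ::
    "'g set \<Rightarrow> 'm set \<Rightarrow> ('g \<times> 'm) set \<Rightarrow> 'g set set \<Rightarrow> bool" where
  "is_finest_extent_partition G M I P \<longleftrightarrow>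
     extent_partition G M I P \<and> (\<forall>Q. extent_partition G M I Q \<longrightarrow> refines G P Q)"

definition finest_extent_partition ::
    "'g set \<Rightarrow> 'm set \<Rightarrow> ('g \<times> 'm) set \<Rightarrow> 'g set set" where
  "finest_extent_partition G M I = (THE P. is_finest_extent_partition G M I P)"

definition box_class :: "'g set \<Rightarrow> 'm set \<Rightarrow> ('g \<times> 'm) set \<Rightarrow> 'g \<Rightarrow> 'g set" where
  "box_class G M I g = (THE A. A \<in> finest_extent_partition G M I \<and> g \<in> A)"

definition box_extents :: "'g set \<Rightarrow> 'm set \<Rightarrow> ('g \<times> 'm) set \<Rightarrow> 'g set set" where
  "box_extents G M I =
     {E. E \<subseteq> G \<and> ((\<exists>P. extent_partition G M I P \<and> E \<in> P) \<or> E = extent_closure G M I {})}"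


section \<open>Classification trees\<close>

text \<open>
  A lattice is given by its carrier \<open>L\<close>, with the order of the ambient type; for sets of
  objects this is inclusion. The least element of the lattice is \<open>LEAST x. x \<in> L\<close>.
\<close>

definition nonzero :: "'a::order set \<Rightarrow> 'a set" where
  "nonzero L = L - {LEAST x. x \<in> L}"

definition up_set :: "'a::order set \<Rightarrow> 'a \<Rightarrow> 'a set" where
  "up_set L x = {y \<in> L. x \<le> y}"

definition classification_tree :: "'a::order set \<Rightarrow> 'a set \<Rightarrow> bool" where
  "classification_tree L T \<longleftrightarrow>
     T \<noteq> {} \<and> T \<subseteq> nonzero L \<and>
     (\<forall>x\<in>nonzero L. up_set L x \<inter> T \<noteq> {} \<and> Complete_Partial_Order.chain (\<le>) (up_set L x \<inter> T))"

definition maximal_classification_tree :: "'a::order set \<Rightarrow> 'a set \<Rightarrow> bool" where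
  "maximal_classification_tree L T \<longleftrightarrow>
     classification_tree L T \<and> \<not> (\<exists>T'. classification_tree L T' \<and> T \<subset> T')"


section \<open>Removing an object\<close>

definition subcontext_incidence :: "'g set \<Rightarrow> 'm set \<Rightarrow> ('g \<times> 'm) set \<Rightarrow> ('g \<times> 'm) set" where
  "subcontext_incidence H M I = I \<inter> (H \<times> M)"

definition star :: "'g set \<Rightarrow> 'm set \<Rightarrow> ('g \<times> 'm) set \<Rightarrow> 'g \<Rightarrow> 'g set set \<Rightarrow> 'g set set" where
  "star G M I z T =
     {E \<in> T. E \<in> box_extents G M I} \<union> {E \<union> {z} | E. E \<in> T \<and> E \<union> {z} \<in> box_extents G M I}"


section \<open>The notions are well defined\<close>

lemma extent_whole: "extent G M I G"
  by (auto simp: extent_def extent_closure_def attribute_derivation_def object_derivation_def)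

lemma extent_Inter:
  assumes "\<And>A. A \<in> \<A> \<Longrightarrow> extent G M I A" "\<A> \<noteq> {}"
  shows "extent G M I (\<Inter>\<A>)"
proof -
  have "x \<in> A" if "x \<in> extent_closure G M I (\<Inter>\<A>)" "A \<in> \<A>" for x A
  proof -
    have "x \<in> extent_closure G M I A"
      using that by (auto simp: extent_closure_def attribute_derivation_def object_derivation_def)
    then show ?thesis using assms(1)[OF that(2)] by (simp add: extent_def)
  qed
  moreover have "\<Inter>\<A> \<subseteq> G" using assms by (auto simp: extent_def)
  moreover have "\<Inter>\<A> \<subseteq> extent_closure G M I (\<Inter>\<A>)" if "\<Inter>\<A> \<subseteq> G"
    using that by (auto simp: extent_closure_def attribute_derivation_def object_derivation_def)
  ultimately show ?thesis unfolding extent_def by blast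
qed

lemma extent_closure_empty_least:
  "extent G M I A \<Longrightarrow> extent_closure G M I {} \<subseteq> A"
  by (force simp: extent_def extent_closure_def attribute_derivation_def object_derivation_def)

lemma extent_closure_empty_extent: "extent G M I (extent_closure G M I {})"
  by (auto simp: extent_def extent_closure_def attribute_derivation_def object_derivation_def)

lemma extent_partition_whole: "G \<noteq> {} \<Longrightarrow> extent_partition G M I {G}"
  by (simp add: extent_partition_def extent_whole partition_on_space)

lemma extent_partition_common_refinement:
  assumes "\<And>P. P \<in> \<P> \<Longrightarrow> extent_partition G M I P" "\<P> \<noteq> {}"
  shows "extent_partition G M I (common_refinement \<P>)"
  unfolding extent_partition_def
proof (intro conjI ballI)
  show "partition_on G (common_refinement \<P>)"
    using assms by (intro partition_on_common_refinement) (auto simp: extent_partition_def)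
next
  fix A assume "A \<in> common_refinement \<P>"
  then obtain f where f: "f \<in> (\<Pi> P\<in>\<P>. P)" "A = \<Inter> (f ` \<P>)"
    by (auto simp: common_refinement)
  show "extent G M I A"
    unfolding f(2) using f(1) assms
    by (intro extent_Inter) (auto simp: extent_partition_def Pi_def)
qed

lemma is_finest_extent_partition_finest_extent_partition:
  assumes "G \<noteq> {}"
  shows "is_finest_extent_partition G M I (finest_extent_partition G M I)"
  unfolding finest_extent_partition_def
proof (rule theI')
  let ?R = "common_refinement {P. extent_partition G M I P}"
  have "extent_partition G M I ?R"
    by (rule extent_partition_common_refinement) (use extent_partition_whole[OF assms] in auto)
  moreover have "refines G ?R Q" if "extent_partition G M I Q" for Q
    by (rule refines_common_refinement) (use that in \<open>auto simp: extent_partition_def\<close>)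
  ultimately have "is_finest_extent_partition G M I ?R"
    by (simp add: is_finest_extent_partition_def)
  moreover have "P = Q" if "is_finest_extent_partition G M I P" "is_finest_extent_partition G M I Q" for P Q
    using that refines_asym unfolding is_finest_extent_partition_def by metis
  ultimately show "\<exists>!P. is_finest_extent_partition G M I P" by blast
qed

lemma box_class:
  assumes "g \<in> G"
  shows "box_class G M I g \<in> finest_extent_partition G M I \<and> g \<in> box_class G M I g"
  unfolding box_class_def
proof (rule theI')
  have "partition_on G (finest_extent_partition G M I)"
    using is_finest_extent_partition_finest_extent_partition[of G M I] assms
    unfolding is_finest_extent_partition_def extent_partition_def by blast
  then show "\<exists>!A. A \<in> finest_extent_partition G M I \<and> g \<in> A"
    using assms by (auto simp: partition_on_def disjoint_def)
qed

lemma box_extent_extent: "E \<in> box_extents G M I \<Longrightarrow> extent G M I E"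
  using extent_closure_empty_extent[of G M I] by (auto simp: box_extents_def extent_partition_def)

lemma Least_box_extents: "(LEAST E. E \<in> box_extents G M I) = extent_closure G M I {}"
proof (rule Least_equality)
  show "extent_closure G M I {} \<in> box_extents G M I"
    using extent_closure_empty_extent[of G M I] by (simp add: box_extents_def extent_def)
qed (rule extent_closure_empty_least[OF box_extent_extent])

lemma whole_box_extent: "G \<in> box_extents G M I"
  using extent_partition_whole[of G M I]
  by (cases "G = {}")
    (auto simp: box_extents_def extent_closure_def attribute_derivation_def)

lemma Int_box_extents:
  assumes "E \<in> box_extents G M I" "F \<in> box_extents G M I"
  shows "E \<inter> F \<in> box_extents G M I"
proof -
  let ?O = "extent_closure G M I {}"
  have O: "?O \<subseteq> E" "?O \<subseteq> F"
    using assms extent_closure_empty_least box_extent_extent by metis+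
  show ?thesis
  proof (cases "E \<inter> F = ?O")
    case True
    then show ?thesis
      using extent_closure_empty_extent[of G M I] by (simp add: box_extents_def extent_def)
  next
    case False
    then have "E \<noteq> ?O" "F \<noteq> ?O" using O by auto
    then obtain P Q where P: "extent_partition G M I P" "E \<in> P" and Q: "extent_partition G M I Q" "F \<in> Q"
      using assms by (auto simp: box_extents_def)
    have ne: "E \<inter> F \<noteq> {}" using False O by auto
    have R: "extent_partition G M I (common_refinement {P, Q})"
      using P Q by (intro extent_partition_common_refinement) auto
    have "E \<inter> F \<in> common_refinement {P, Q}"
    proof (cases "P = Q")
      case True
      then have "E = F"
        using P Q ne by (auto simp: extent_partition_def partition_on_def disjoint_def)
      then show ?thesis
        using P(2) ne True by (auto simp: common_refinement intro!: bexI[of _ "\<lambda>_. E"])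
    next
      case False
      let ?f = "\<lambda>X. if X = P then E else F"
      have "?f \<in> (\<Pi> X\<in>{P, Q}. X)" "\<Inter> (?f ` {P, Q}) = E \<inter> F"
        using False P(2) Q(2) by auto
      then show ?thesis using ne unfolding common_refinement by blast
    qed
    then show ?thesis using R assms by (auto simp: box_extents_def)
  qed
qed


section \<open>The degenerate case\<close>

text \<open>
  If \<open>\<emptyset>'' = G - {z}\<close>, that is, if every object except \<open>z\<close> has all attributes, then the box
  extents of the subcontext form a one-element lattice. This lattice has no classification tree,
  whereas \<open>{G}\<close> is one for the whole context, although the class of \<open>z\<close> is not \<open>{z}\<close>.
  This case therefore has to be excluded.
\<close>

lemma degenerate_subcontext:
  assumes "z \<in> G" "G \<noteq> {z}" "extent_closure G M I {} = G - {z}"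
  defines "H \<equiv> G - {z}"
  shows "box_class G M I z \<noteq> {z}"
    and "maximal_classification_tree (box_extents G M I) {G}"
    and "\<not> classification_tree (box_extents H M (subcontext_incidence H M I)) T"
proof -
  have H: "H \<noteq> {}" using assms by auto
  have ext: "A = G \<or> A = H" if "extent G M I A" for A
    using extent_closure_empty_least[OF that] that assms by (auto simp: extent_def)
  have "extent G M I (box_class G M I z)"
    using box_class[OF assms(1), of M I] is_finest_extent_partition_finest_extent_partition[of G M I] assms(1)
    unfolding is_finest_extent_partition_def extent_partition_def by blast
  from ext[OF this] show "box_class G M I z \<noteq> {z}"
    using assms by auto
  have "box_extents G M I \<subseteq> {G, H}"
    using ext assms by (auto simp: box_extents_def extent_partition_def)
  moreover have "G \<in> box_extents G M I"
    by (rule whole_box_extent)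
  moreover have "H \<in> box_extents G M I"
    using assms(3) by (auto simp: box_extents_def H_def)
  ultimately have "box_extents G M I = {G, H}" by blast
  moreover have "(LEAST E. E \<in> box_extents G M I) = H"
    using assms by (simp add: Least_box_extents)
  moreover have "G \<noteq> H" using assms by auto
  ultimately have nz: "nonzero (box_extents G M I) = {G}"
    by (auto simp: nonzero_def)
  then show "maximal_classification_tree (box_extents G M I) {G}"
    unfolding maximal_classification_tree_def classification_tree_def nz
    by (auto simp: up_set_def whole_box_extent Complete_Partial_Order.chain_def)
  let ?J = "subcontext_incidence H M I"
  have least: "extent_closure H M ?J {} = H"
    using assms(3) unfolding H_def
    by (auto simp: extent_closure_def attribute_derivation_def object_derivation_def
        subcontext_incidence_def)
  have "E = H" if "E \<in> box_extents H M ?J" for E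
    using that extent_closure_empty_least[of H M ?J E] least
    by (auto simp: box_extents_def extent_partition_def)
  then have "nonzero (box_extents H M ?J) = {}"
    unfolding nonzero_def Least_box_extents least by auto
  then show "\<not> classification_tree (box_extents H M ?J) T"
    by (auto simp: classification_tree_def)
qed

end

theory Submission
  imports Defs
begin

text \<open>
  Restriction \<open>E \<mapsto> E \<inter> H\<close> maps the box extents of the whole context to those of the subcontext,
  because the traces on \<open>H\<close> of the classes of an extent partition are extents of the subcontext
  (\<open>box_extent_restrict\<close>). It preserves meets, the least and the greatest element, and it is
  injective (\<open>inj_on_restrict\<close>): if \<open>E\<close> and \<open>E \<union> {z}\<close>, with \<open>z \<notin> E\<close>, were both box extents and
  \<open>E\<close> were a class of some extent partition, then the finest class around \<open>z\<close> would lie inside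
  \<open>E \<union> {z}\<close> and be disjoint from \<open>E\<close>, so it would be \<open>{z}\<close>; and if \<open>E\<close> is only the least element
  \<open>\<emptyset>''\<close>, then either \<open>\<emptyset>''\<close> is empty and the same conclusion follows, or all classes of all extent
  partitions meet in \<open>\<emptyset>''\<close>, which leaves only the partition \<open>{G}\<close> and forces \<open>\<emptyset>'' = G - {z}\<close>.

  Since \<open>T\<^sup>*\<close> is exactly the preimage of \<open>T\<close> under this embedding (\<open>star_eq_preimage\<close>), the
  theorem becomes one about an injective meet homomorphism \<open>f\<close> that preserves both bounds. Images
  of classification trees under \<open>f\<close> are classification trees, and so are preimages. The image of
  \<open>T_G\<close> settles the first claim, since its preimage is again \<open>T_G\<close>. For the second claim, extend
  the image to a maximal tree; its preimage is a tree that contains the maximal tree \<open>T_G\<close>, hence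
  it equals \<open>T_G\<close>.
\<close>

section \<open>Classification trees along meet embeddings\<close>

lemma classification_tree_extend_maximal:
  assumes "finite L" "classification_tree L T"
  obtains T' where "maximal_classification_tree L T'" "T \<subseteq> T'"
proof -
  let ?A = "{T. classification_tree L T}"
  have "?A \<subseteq> Pow L"
    by (auto simp: classification_tree_def nonzero_def)
  then have "finite ?A"
    using assms(1) by (auto intro: finite_subset)
  then obtain T' where "T' \<in> ?A" "T \<subseteq> T'" "\<forall>S\<in>?A. T' \<subseteq> S \<longrightarrow> T' = S"
    using finite_has_maximal2[of ?A T] assms(2) by auto
  then show thesis
    by (intro that[of T']) (auto simp: maximal_classification_tree_def)
qed

lemma greatest_in_classification_tree:
  assumes "classification_tree L T" "t \<in> L" "\<And>x. x \<in> L \<Longrightarrow> x \<le> t"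
    and least: "\<And>x. x \<in> L \<Longrightarrow> (LEAST x. x \<in> L) \<le> x"
  shows "t \<in> T"
proof -
  obtain y where y: "y \<in> nonzero L"
    using assms(1) by (auto simp: classification_tree_def)
  have "t \<noteq> (LEAST x. x \<in> L)"
    using y assms(3)[of y] least[of y] by (auto simp: nonzero_def)
  then have "t \<in> nonzero L"
    using assms(2) by (simp add: nonzero_def)
  then obtain u where "u \<in> T" "u \<in> L" "t \<le> u"
    using assms(1) by (fastforce simp: classification_tree_def up_set_def)
  then show ?thesis
    using assms(3)[of u] by auto
qed

locale bounded_meet_embedding =
  fixes L :: "'a::semilattice_inf set" and K :: "'b::semilattice_inf set"
    and f :: "'a \<Rightarrow> 'b" and t :: 'a
  assumes inf_closed: "x \<in> L \<Longrightarrow> y \<in> L \<Longrightarrow> inf x y \<in> L"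
    and least_L: "x \<in> L \<Longrightarrow> (LEAST x. x \<in> L) \<le> x"
    and least_K: "v \<in> K \<Longrightarrow> (LEAST v. v \<in> K) \<le> v"
    and least_in: "(LEAST x. x \<in> L) \<in> L"
    and greatest_in: "t \<in> L"
    and greatest_L: "x \<in> L \<Longrightarrow> x \<le> t"
    and greatest_K: "v \<in> K \<Longrightarrow> v \<le> f t"
    and map_in: "x \<in> L \<Longrightarrow> f x \<in> K"
    and map_inf: "x \<in> L \<Longrightarrow> y \<in> L \<Longrightarrow> f (inf x y) = inf (f x) (f y)"
    and map_least: "f (LEAST x. x \<in> L) = (LEAST v. v \<in> K)"
    and inj: "inj_on f L"
begin

lemma mono: "x \<in> L \<Longrightarrow> y \<in> L \<Longrightarrow> x \<le> y \<Longrightarrow> f x \<le> f y"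
  using map_inf[of x y] by (simp add: inf_absorb1 le_iff_inf)

lemma reflects_le:
  assumes "x \<in> L" "y \<in> L" "f x \<le> f y"
  shows "x \<le> y"
proof -
  have "f (inf x y) = f x"
    using assms map_inf by (simp add: inf_absorb1)
  then show ?thesis
    using assms inf_closed inj by (metis inj_onD inf_le2)
qed

lemma map_nonzero_iff: "x \<in> L \<Longrightarrow> f x \<in> nonzero K \<longleftrightarrow> x \<in> nonzero L"
  using map_least map_in inj least_in by (auto simp: nonzero_def inj_on_def)

text \<open>
  Two members \<open>f a\<close>, \<open>f b\<close> of the image above a nonzero \<open>y\<close> are comparable because \<open>a\<close> and \<open>b\<close>
  lie above their meet, which is nonzero since its image lies above \<open>y\<close>.
\<close>

lemma classification_tree_image:
  assumes T: "classification_tree L T"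
  shows "classification_tree K (f ` T)"
proof -
  have TL: "T \<subseteq> nonzero L" "T \<noteq> {}" and TL': "T \<subseteq> L"
    using T by (auto simp: classification_tree_def nonzero_def)
  have t: "t \<in> T"
    using greatest_in_classification_tree[OF T greatest_in greatest_L least_L] .
  have "f a \<le> f b \<or> f b \<le> f a"
    if y: "y \<in> nonzero K" and a: "a \<in> T" "y \<le> f a" and b: "b \<in> T" "y \<le> f b" for y a b
  proof -
    have ab: "a \<in> L" "b \<in> L" using a b TL' by auto
    have y': "y \<in> K" "y \<noteq> (LEAST y. y \<in> K)"
      using y by (auto simp: nonzero_def)
    have "y \<le> f (inf a b)"
      using a b ab map_inf by simp
    then have "inf a b \<noteq> (LEAST x. x \<in> L)"
      using map_least y' least_K by (metis order.antisym)
    then have "inf a b \<in> nonzero L"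
      using inf_closed ab by (simp add: nonzero_def)
    then have "Complete_Partial_Order.chain (\<le>) (up_set L (inf a b) \<inter> T)"
      using T by (auto simp: classification_tree_def)
    moreover have "a \<in> up_set L (inf a b) \<inter> T" "b \<in> up_set L (inf a b) \<inter> T"
      using a b ab by (auto simp: up_set_def)
    ultimately have "a \<le> b \<or> b \<le> a"
      by (auto simp: Complete_Partial_Order.chain_def)
    then show ?thesis using mono ab by auto
  qed
  moreover have "f t \<in> up_set K y \<inter> f ` T" if "y \<in> nonzero K" for y
    using that t greatest_K map_in greatest_in by (auto simp: up_set_def nonzero_def)
  moreover have "f ` T \<subseteq> nonzero K"
    using TL TL' map_nonzero_iff by blast
  ultimately show ?thesis
    using TL(2) unfolding classification_tree_def Complete_Partial_Order.chain_def up_set_def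
    by blast
qed

text \<open>
  Comparability passes back from \<open>f a\<close>, \<open>f b\<close> to \<open>a\<close>, \<open>b\<close> because an injective meet homomorphism
  reflects the order; injectivity also keeps \<open>f x\<close> nonzero, so that the chain condition of
  \<open>T\<close> applies above \<open>f x\<close>.
\<close>

lemma classification_tree_preimage:
  assumes T: "classification_tree K T"
  shows "classification_tree L {x \<in> L. f x \<in> T}"
proof -
  let ?S = "{x \<in> L. f x \<in> T}"
  have TK: "T \<subseteq> nonzero K"
    using T by (auto simp: classification_tree_def)
  have "f t \<in> T"
    using greatest_in_classification_tree[OF T map_in[OF greatest_in] greatest_K least_K] .
  then have t: "t \<in> ?S"
    using greatest_in by simp
  have "a \<le> b \<or> b \<le> a"
    if x: "x \<in> nonzero L" and a: "a \<in> ?S" "x \<le> a" and b: "b \<in> ?S" "x \<le> b" for x a b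
  proof -
    have x': "x \<in> L" "f x \<in> nonzero K"
      using x map_nonzero_iff by (auto simp: nonzero_def)
    have "Complete_Partial_Order.chain (\<le>) (up_set K (f x) \<inter> T)"
      using T x' by (auto simp: classification_tree_def)
    moreover have "f a \<in> up_set K (f x) \<inter> T" "f b \<in> up_set K (f x) \<inter> T"
      using a b x' mono map_in by (auto simp: up_set_def)
    ultimately have "f a \<le> f b \<or> f b \<le> f a"
      by (auto simp: Complete_Partial_Order.chain_def)
    then show ?thesis using reflects_le a b by auto
  qed
  moreover have "t \<in> up_set L x \<inter> ?S" if "x \<in> nonzero L" for x
    using that t greatest_L by (auto simp: up_set_def nonzero_def)
  moreover have "?S \<subseteq> nonzero L"
    using TK map_nonzero_iff by blast
  ultimately show ?thesis
    using t unfolding classification_tree_def Complete_Partial_Order.chain_def up_set_def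
    by blast
qed

lemma preimage_image_tree: "classification_tree L T \<Longrightarrow> {x \<in> L. f x \<in> f ` T} = T"
  using inj by (auto simp: classification_tree_def nonzero_def inj_on_def)

lemma maximal_classification_tree_preimage:
  assumes "finite K" "maximal_classification_tree L T"
  obtains S where "maximal_classification_tree K S" "T = {x \<in> L. f x \<in> S}"
proof -
  have T: "classification_tree L T"
    using assms(2) by (simp add: maximal_classification_tree_def)
  obtain S where S: "maximal_classification_tree K S" "f ` T \<subseteq> S"
    using classification_tree_extend_maximal[OF assms(1) classification_tree_image[OF T]] .
  have "T \<subseteq> {x \<in> L. f x \<in> S}"
    using S(2) preimage_image_tree[OF T] by blast
  moreover have "classification_tree L {x \<in> L. f x \<in> S}"
    using S(1) classification_tree_preimage by (simp add: maximal_classification_tree_def)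
  ultimately have "T = {x \<in> L. f x \<in> S}"
    using assms(2) unfolding maximal_classification_tree_def by blast
  with S(1) show thesis by (rule that)
qed

end


section \<open>Restricting box extents to a subcontext\<close>

lemma extent_restrict:
  assumes "H \<subseteq> G" "extent G M I A"
  shows "extent H M (subcontext_incidence H M I) (A \<inter> H)"
proof -
  let ?J = "subcontext_incidence H M I"
  have "extent_closure H M ?J (A \<inter> H) \<subseteq> extent_closure G M I A"
    using assms(1)
    by (auto simp: extent_closure_def attribute_derivation_def object_derivation_def
        subcontext_incidence_def)
  moreover have "extent_closure H M ?J (A \<inter> H) \<subseteq> H"
    by (auto simp: extent_closure_def attribute_derivation_def)
  moreover have "A \<inter> H \<subseteq> extent_closure H M ?J (A \<inter> H)"
    by (auto simp: extent_closure_def attribute_derivation_def object_derivation_def)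
  ultimately show ?thesis
    using assms(2) unfolding extent_def by blast
qed

lemma extent_partition_restrict:
  assumes "H \<subseteq> G" "extent_partition G M I P"
  shows "extent_partition H M (subcontext_incidence H M I) ((\<lambda>A. A \<inter> H) ` P - {{}})"
proof -
  have "disjoint ((\<lambda>A. A \<inter> H) ` P - {{}})"
    using assms(2) by (fastforce simp: extent_partition_def partition_on_def disjoint_def)
  moreover have "\<Union>((\<lambda>A. A \<inter> H) ` P - {{}}) = \<Union>P \<inter> H"
    by blast
  moreover have "\<Union>P \<inter> H = H"
    using assms by (auto simp: extent_partition_def partition_on_def)
  ultimately have "partition_on H ((\<lambda>A. A \<inter> H) ` P - {{}})"
    by (simp add: partition_on_def)
  then show ?thesis
    using assms(2) extent_restrict[OF assms(1)] by (auto simp: extent_partition_def)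
qed

lemma extent_closure_empty_restrict:
  assumes "H \<subseteq> G"
  shows "extent_closure H M (subcontext_incidence H M I) {} = extent_closure G M I {} \<inter> H"
  using assms
  by (auto simp: extent_closure_def attribute_derivation_def object_derivation_def
      subcontext_incidence_def)

lemma box_extent_cases:
  assumes "E \<in> box_extents G M I"
  obtains P where "extent_partition G M I P" "E \<in> P" | "E = extent_closure G M I {}"
  using assms by (auto simp: box_extents_def)

lemma box_extent_restrict:
  assumes "H \<subseteq> G" "E \<in> box_extents G M I"
  shows "E \<inter> H \<in> box_extents H M (subcontext_incidence H M I)"
proof (cases "E \<inter> H = extent_closure H M (subcontext_incidence H M I) {}")
  case True
  moreover have "E \<inter> H \<subseteq> H" by simp
  ultimately show ?thesis by (simp add: box_extents_def)
next
  case False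
  then have "E \<noteq> extent_closure G M I {}"
    using extent_closure_empty_restrict[OF assms(1)] by auto
  then obtain P where P: "extent_partition G M I P" "E \<in> P"
    using assms(2) by (auto elim: box_extent_cases)
  \<comment> \<open>An empty trace would be an extent, hence equal to the least one.\<close>
  have "extent_closure H M (subcontext_incidence H M I) {} \<subseteq> E \<inter> H"
    using extent_closure_empty_least extent_restrict[OF assms(1)] box_extent_extent assms(2)
    by metis
  then have "E \<inter> H \<noteq> {}"
    using False by blast
  then show ?thesis
    using extent_partition_restrict[OF assms(1) P(1)] P(2) unfolding box_extents_def by blast
qed

lemma extent_partition_box_class:
  assumes "extent_partition G M I P" "g \<in> G"
  obtains A where "A \<in> P" "g \<in> A" "box_class G M I g \<subseteq> A"
proof -
  have "refines G (finest_extent_partition G M I) P"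
    using is_finest_extent_partition_finest_extent_partition[of G M I] assms
    unfolding is_finest_extent_partition_def by blast
  then obtain A where "A \<in> P" "box_class G M I g \<subseteq> A"
    using box_class[OF assms(2), of M I] unfolding refines_def by blast
  then show thesis
    using that box_class[OF assms(2), of M I] by blast
qed

lemma box_class_subset_class:
  assumes "extent_partition G M I P" "A \<in> P" "g \<in> A"
  shows "box_class G M I g \<subseteq> A"
proof -
  have part: "partition_on G P"
    using assms(1) by (simp add: extent_partition_def)
  then have "g \<in> G"
    using assms(2,3) by (auto simp: partition_on_def)
  then obtain B where B: "B \<in> P" "g \<in> B" "box_class G M I g \<subseteq> B"
    using extent_partition_box_class assms(1) by metis
  then have "A = B"
    using part assms(2,3) by (auto simp: partition_on_def disjoint_def)
  then show ?thesis using B by simp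
qed

lemma box_class_disjoint_class:
  assumes "extent_partition G M I P" "A \<in> P" "g \<in> G" "g \<notin> A"
  shows "box_class G M I g \<inter> A = {}"
proof -
  obtain B where B: "B \<in> P" "g \<in> B" "box_class G M I g \<subseteq> B"
    using extent_partition_box_class assms(1,3) by metis
  then have "A \<noteq> B" using assms(4) by auto
  then have "A \<inter> B = {}"
    using B(1) assms(1,2) by (auto simp: extent_partition_def partition_on_def disjoint_def)
  then show ?thesis using B(3) by blast
qed

text \<open>All extents, and hence all classes of an extent partition, contain \<open>\<emptyset>''\<close>.\<close>

lemma extent_partition_trivial:
  assumes "extent_closure G M I {} \<noteq> {}" "extent_partition G M I P" "A \<in> P"
  shows "A = G"
proof -
  have least: "extent_closure G M I {} \<subseteq> B" if "B \<in> P" for B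
    using extent_closure_empty_least assms(2) that by (metis extent_partition_def)
  have part: "partition_on G P"
    using assms(2) by (simp add: extent_partition_def)
  have "B = A" if "B \<in> P" for B
  proof -
    have "B \<inter> A \<noteq> {}"
      using least[OF that] least[OF assms(3)] assms(1) by blast
    then show ?thesis
      using part that assms(3) by (auto simp: partition_on_def disjoint_def)
  qed
  then have "P = {A}"
    using assms(3) by blast
  then show ?thesis
    using part by (simp add: partition_on_def)
qed

text \<open>
  This is where the hypotheses on \<open>z\<close> enter: two box extents that differ only in \<open>z\<close> either
  isolate \<open>z\<close> in the finest extent partition or are \<open>\<emptyset>'' = G - {z}\<close> and \<open>G\<close>.
\<close>

lemma insert_not_box_extent:
  assumes z: "z \<in> G" "box_class G M I z \<noteq> {z}" "extent_closure G M I {} \<noteq> G - {z}"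
    and E: "E \<in> box_extents G M I" "z \<notin> E"
  shows "insert z E \<notin> box_extents G M I"
proof
  let ?O = "extent_closure G M I {}"
  assume F: "insert z E \<in> box_extents G M I"
  have "?O \<subseteq> E"
    using extent_closure_empty_least box_extent_extent E(1) by metis
  then have "insert z E \<noteq> ?O"
    using E(2) by auto
  then obtain Q where Q: "extent_partition G M I Q" "insert z E \<in> Q"
    using F by (auto elim: box_extent_cases)
  have le: "box_class G M I z \<subseteq> insert z E" and mem: "z \<in> box_class G M I z"
    using box_class_subset_class[OF Q] box_class[OF z(1), of M I] by auto
  from E(1) show False
  proof (cases rule: box_extent_cases)
    case (1 P)
    then show False
      using box_class_disjoint_class[OF 1 z(1) E(2)] le mem z(2) by blast
  next
    case 2
    show False
    proof (cases "?O = {}")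
      case True
      then show False using 2 le mem z(2) by auto
    next
      case False
      then have "insert z E = G"
        using extent_partition_trivial Q by metis
      then show False using 2 E(2) z(3) by auto
    qed
  qed
qed

lemma inj_on_restrict:
  assumes "z \<in> G" "box_class G M I z \<noteq> {z}" "extent_closure G M I {} \<noteq> G - {z}"
  shows "inj_on (\<lambda>E. E \<inter> (G - {z})) (box_extents G M I)"
proof (rule inj_onI)
  fix E F
  assume E: "E \<in> box_extents G M I" and F: "F \<in> box_extents G M I"
    and eq: "E \<inter> (G - {z}) = F \<inter> (G - {z})"
  have "E \<subseteq> G" "F \<subseteq> G"
    using E F by (auto simp: box_extents_def)
  then have "E = F \<or> z \<notin> E \<and> F = insert z E \<or> z \<notin> F \<and> E = insert z F"
    using eq by blast
  then show "E = F"
    using insert_not_box_extent[OF assms] E F by metis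
qed

lemma bounded_meet_embedding_restrict:
  assumes "z \<in> G" "box_class G M I z \<noteq> {z}" "extent_closure G M I {} \<noteq> G - {z}"
  defines "H \<equiv> G - {z}"
  shows "bounded_meet_embedding (box_extents G M I)
           (box_extents H M (subcontext_incidence H M I)) (\<lambda>E. E \<inter> H) G"
proof -
  have HG: "H \<subseteq> G" by (auto simp: H_def)
  have least: "(LEAST E. E \<in> box_extents X M J) \<le> E" if "E \<in> box_extents X M J"
    for X :: "'a set" and J E
    using extent_closure_empty_least[OF box_extent_extent[OF that]] by (simp add: Least_box_extents)
  show ?thesis
  proof
    show "(LEAST E. E \<in> box_extents G M I) \<in> box_extents G M I"
      unfolding Least_box_extents using extent_closure_empty_extent[of G M I]
      by (simp add: box_extents_def extent_def)
    show "E \<le> G" if "E \<in> box_extents G M I" for E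
      using that by (simp add: box_extents_def)
    show "(LEAST E. E \<in> box_extents G M I) \<inter> H =
        (LEAST E. E \<in> box_extents H M (subcontext_incidence H M I))"
      by (simp add: Least_box_extents extent_closure_empty_restrict[OF HG])
    show "inj_on (\<lambda>E. E \<inter> H) (box_extents G M I)"
      using inj_on_restrict[OF assms(1-3)] by (simp add: H_def)
    show "E \<le> G \<inter> H" if "E \<in> box_extents H M (subcontext_incidence H M I)" for E
      using that HG by (auto simp: box_extents_def)
  qed (auto intro!: least whole_box_extent Int_box_extents box_extent_restrict[OF HG])
qed

lemma star_eq_preimage:
  assumes "\<Union>T \<subseteq> G - {z}"
  shows "star G M I z T = {E \<in> box_extents G M I. E \<inter> (G - {z}) \<in> T}"
proof (intro equalityI subsetI)
  fix E assume "E \<in> star G M I z T"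
  then consider "E \<in> T" "E \<in> box_extents G M I"
    | D where "D \<in> T" "E = insert z D" "E \<in> box_extents G M I"
    by (auto simp: star_def)
  then show "E \<in> {E \<in> box_extents G M I. E \<inter> (G - {z}) \<in> T}"
  proof cases
    case 1
    then have "E \<inter> (G - {z}) = E" using assms by blast
    then show ?thesis using 1 by simp
  next
    case 2
    then have "E \<inter> (G - {z}) = D" using assms by blast
    then show ?thesis using 2 by simp
  qed
next
  fix E assume E: "E \<in> {E \<in> box_extents G M I. E \<inter> (G - {z}) \<in> T}"
  then have EG: "E \<subseteq> G" by (auto simp: box_extents_def)
  show "E \<in> star G M I z T"
  proof (cases "z \<in> E")
    case True
    then have "E \<inter> (G - {z}) \<union> {z} = E" using EG by blast
    then have "E = E \<inter> (G - {z}) \<union> {z} \<and> E \<inter> (G - {z}) \<in> T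
        \<and> E \<inter> (G - {z}) \<union> {z} \<in> box_extents G M I"
      using E by simp
    then show ?thesis unfolding star_def by blast
  next
    case False
    then have "E \<inter> (G - {z}) = E" using EG by blast
    then show ?thesis using E unfolding star_def by auto
  qed
qed


section \<open>Classification trees after removing an object\<close>

theorem theorem3p9:
  fixes G :: "'g set" and M :: "'m set" and I :: "('g \<times> 'm) set" and z :: 'g
  defines "H \<equiv> G - {z}"
  defines "I_H \<equiv> subcontext_incidence H M I"
  assumes "finite G" and "G \<noteq> {}" and "finite M" and "M \<noteq> {}" and "I \<subseteq> G \<times> M"
    and "\<forall>g\<in>G. \<exists>m\<in>M. (g, m) \<in> I" and "\<forall>m\<in>M. \<exists>g\<in>G. (g, m) \<in> I"
    and "z \<in> G" and "box_class G M I z \<noteq> {z}"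
    and "extent_closure G M I {} \<noteq> G - {z}"
  shows "(\<forall>T_G. classification_tree (box_extents G M I) T_G \<longrightarrow>
            (\<exists>T_H. classification_tree (box_extents H M I_H) T_H \<and> T_G = star G M I z T_H)) \<and>
         (\<forall>T_G. maximal_classification_tree (box_extents G M I) T_G \<longrightarrow>
            (\<exists>T_M. maximal_classification_tree (box_extents H M I_H) T_M \<and> T_G = star G M I z T_M))"
proof -
  let ?L = "box_extents G M I" and ?K = "box_extents H M I_H"
  interpret bounded_meet_embedding ?L ?K "\<lambda>E. E \<inter> H" G
    unfolding I_H_def H_def
    by (rule bounded_meet_embedding_restrict) (use assms in \<open>auto simp: H_def\<close>)
  have star: "star G M I z T = {E \<in> ?L. E \<inter> H \<in> T}" if "classification_tree ?K T" for T
  proof -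
    have "\<Union>T \<subseteq> G - {z}"
      using that by (auto simp: classification_tree_def nonzero_def box_extents_def H_def)
    then show ?thesis
      unfolding H_def by (rule star_eq_preimage)
  qed
  have "?K \<subseteq> Pow H"
    by (auto simp: box_extents_def)
  moreover have "finite H"
    using \<open>finite G\<close> by (simp add: H_def)
  ultimately have fin: "finite ?K"
    by (meson finite_Pow_iff finite_subset)
  show ?thesis
  proof (intro conjI allI impI)
    fix T assume T: "classification_tree ?L T"
    show "\<exists>T_H. classification_tree ?K T_H \<and> T = star G M I z T_H"
      using classification_tree_image[OF T] preimage_image_tree[OF T] star by metis
  next
    fix T assume "maximal_classification_tree ?L T"
    then obtain S where "maximal_classification_tree ?K S" "T = {E \<in> ?L. E \<inter> H \<in> S}"
      using maximal_classification_tree_preimage[OF fin] by metis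
    then show "\<exists>T_M. maximal_classification_tree ?K T_M \<and> T = star G M I z T_M"
      using star by (metis maximal_classification_tree_def)
  qed
qed

end
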